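(* (i) The calculus ${\bf SC}_{\mathcal{TML}}$ is sound and complete with respect to the matrix $\mathcal{M}_4$: a sequent $\Gamma\Rightarrow\Delta$ is provable in ${\bf SC}_{\mathcal{TML}}$ if and only if it is valid in $\mathcal{M}_4$. (ii) The cut rule is admissible in ${\bf SC}_{\mathcal{TML}}$: every sequent provable in ${\bf SC}_{\mathcal{TML}}$ is provable in it without using the cut rule.
   Context: Formulas are built from a denumerable set of propositional variables with connectives $\vee,\wedge$ (binary), $\neg,\square$ (unary); $Fm$ denotes the set of formulas. Matrix $\mathcal{M}_4$: truth values $\{0,{\bf n},{\bf b},1\}$, ordered as the four-element lattice with bottom $0$, top $1$ and ${\bf n},{\bf b}$ incomparable; designated values $\mathcal{D}=\{{\bf b},1\}$; $\vee,\wedge$ are interpreted as supremum and infimum; $\neg 0=1$, $\neg{\bf n}={\bf n}$, $\neg{\bf b}={\bf b}$, $\neg1=0$; $\square0=\square{\bf n}=\square{\bf b}=0$, $\square1=1$. A valuation is a function $v:Fm\to\{0,{\bf n},{\bf b},1\}$ commuting with the connectives; $v$ satisfies a formula $\alpha$ if $v(\alpha)\in\mathcal{D}$. A sequent $\Gamma\Rightarrow\Delta$ ($\Gamma,\Delta$ finite, possibly empty, sets of formulas) is satisfied by $v$ if $v$ fails to satisfy some formula of $\Gamma$ or satisfies some formula of $\Delta$; it is valid in $\mathcal{M}_4$ if every valuation satisfies it. The calculus ${\bf SC}_{\mathcal{TML}}$ has the axioms $\alpha\Rightarrow\alpha$ and the following rules (premises / conclusion), where commas denote union of sets: Cut: $\Gamma\Rightarrow\Delta,\alpha$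 and $\Gamma,\alpha\Rightarrow\Delta$ / $\Gamma\Rightarrow\Delta$. Weakening: $\Gamma\Rightarrow\Delta$ / $\Gamma,\alpha\Rightarrow\Delta$; and $\Gamma\Rightarrow\Delta$ / $\Gamma\Rightarrow\Delta,\alpha$. ($\vee\Rightarrow$) $\Gamma,\alpha\Rightarrow\Delta$ and $\Gamma,\beta\Rightarrow\Delta$ / $\Gamma,\alpha\vee\beta\Rightarrow\Delta$. ($\Rightarrow\vee$) $\Gamma\Rightarrow\Delta,\alpha,\beta$ / $\Gamma\Rightarrow\Delta,\alpha\vee\beta$. ($\neg\vee\Rightarrow$) $\Gamma,\neg\alpha,\neg\beta\Rightarrow\Delta$ / $\Gamma,\neg(\alpha\vee\beta)\Rightarrow\Delta$. ($\Rightarrow\neg\vee$) $\Gamma\Rightarrow\Delta,\neg\alpha$ and $\Gamma\Rightarrow\Delta,\neg\beta$ / $\Gamma\Rightarrow\Delta,\neg(\alpha\vee\beta)$. ($\wedge\Rightarrow$) $\Gamma,\alpha,\beta\Rightarrow\Delta$ / $\Gamma,\alpha\wedge\beta\Rightarrow\Delta$. ($\Rightarrow\wedge$) $\Gamma\Rightarrow\Delta,\alpha$ and $\Gamma\Rightarrow\Delta,\beta$ / $\Gamma\Rightarrow\Delta,\alpha\wedge\beta$. ($\neg\wedge\Rightarrow$) $\Gamma,\neg\alpha\Rightarrow\Delta$ and $\Gamma,\neg\beta\Rightarrow\Delta$ / $\Gamma,\neg(\alpha\wedge\beta)\Rightarrow\Delta$. ($\Rightarrow\neg\wedge$) $\Gamma\Rightarrow\Delta,\neg\alpha,\neg\beta$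 / $\Gamma\Rightarrow\Delta,\neg(\alpha\wedge\beta)$. ($\neg\neg\Rightarrow$) $\Gamma,\alpha\Rightarrow\Delta$ / $\Gamma,\neg\neg\alpha\Rightarrow\Delta$. ($\Rightarrow\neg\neg$) $\Gamma\Rightarrow\Delta,\alpha$ / $\Gamma\Rightarrow\Delta,\neg\neg\alpha$. ($\square\Rightarrow$)$_1$ $\Gamma,\alpha\Rightarrow\Delta$ / $\Gamma,\square\alpha\Rightarrow\Delta$. ($\square\Rightarrow$)$_2$ $\Gamma\Rightarrow\Delta,\neg\alpha$ / $\Gamma,\square\alpha\Rightarrow\Delta$. ($\Rightarrow\square$) $\Gamma\Rightarrow\Delta,\alpha$ and $\Gamma,\neg\alpha\Rightarrow\Delta$ / $\Gamma\Rightarrow\Delta,\square\alpha$. ($\neg\square\Rightarrow$) $\Gamma\Rightarrow\Delta,\alpha$ and $\Gamma,\neg\alpha\Rightarrow\Delta$ / $\Gamma,\neg\square\alpha\Rightarrow\Delta$. ($\Rightarrow\neg\square$)$_1$ $\Gamma,\alpha\Rightarrow\Delta$ / $\Gamma\Rightarrow\Delta,\neg\square\alpha$. ($\Rightarrow\neg\square$)$_2$ $\Gamma\Rightarrow\Delta,\neg\alpha$ / $\Gamma\Rightarrow\Delta,\neg\square\alpha$. A sequent is provable if it has a derivation from the axioms by these rules. *)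

theory Defs
  imports Main "HOL-Library.FSet"
begin

datatype fm =
    Var nat
  | Disj fm fm
  | Conj fm fm
  | Neg fm
  | Box fm

datatype tv = Zero | N | B | One

instantiation tv :: bounded_lattice
begin

definition less_eq_tv :: "tv \<Rightarrow> tv \<Rightarrow> bool" where
  "x \<le> y \<longleftrightarrow> x = Zero \<or> y = One \<or> x = y"

definition less_tv :: "tv \<Rightarrow> tv \<Rightarrow> bool" where
  "x < y \<longleftrightarrow> x \<le> y \<and> x \<noteq> (y :: tv)"

definition sup_tv :: "tv \<Rightarrow> tv \<Rightarrow> tv" where
  "sup x y = (if x \<le> y then y else if y \<le> x then x else One)"

definition inf_tv :: "tv \<Rightarrow> tv \<Rightarrow> tv" where
  "inf x y = (if x \<le> y then x else if y \<le> x then y else Zero)"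

definition bot_tv :: tv where
  "bot = Zero"

definition top_tv :: tv where
  "top = One"

instance
  by standard
    (auto simp: less_eq_tv_def less_tv_def sup_tv_def inf_tv_def bot_tv_def top_tv_def
      split: if_splits)

end

primrec neg_tv :: "tv \<Rightarrow> tv" where
  "neg_tv Zero = One"
| "neg_tv N = N"
| "neg_tv B = B"
| "neg_tv One = Zero"

primrec box_tv :: "tv \<Rightarrow> tv" where
  "box_tv Zero = Zero"
| "box_tv N = Zero"
| "box_tv B = Zero"
| "box_tv One = One"

definition designated :: "tv set" where
  "designated = {B, One}"

definition valuation :: "(fm \<Rightarrow> tv) \<Rightarrow> bool" where
  "valuation v \<longleftrightarrow>
    (\<forall>\<alpha> \<beta>. v (Disj \<alpha> \<beta>) = sup (v \<alpha>) (v \<beta>)) \<and>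
    (\<forall>\<alpha> \<beta>. v (Conj \<alpha> \<beta>) = inf (v \<alpha>) (v \<beta>)) \<and>
    (\<forall>\<alpha>. v (Neg \<alpha>) = neg_tv (v \<alpha>)) \<and>
    (\<forall>\<alpha>. v (Box \<alpha>) = box_tv (v \<alpha>))"

definition satisfies :: "(fm \<Rightarrow> tv) \<Rightarrow> fm \<Rightarrow> bool" where
  "satisfies v \<alpha> \<longleftrightarrow> v \<alpha> \<in> designated"

text \<open>A sequent is given by its two sides, passed as separate arguments.\<close>

definition satisfies_sequent :: "(fm \<Rightarrow> tv) \<Rightarrow> fm fset \<Rightarrow> fm fset \<Rightarrow> bool" where
  "satisfies_sequent v \<Gamma> \<Delta> \<longleftrightarrow>
    (\<exists>\<alpha>. \<alpha> |\<in>| \<Gamma> \<and> \<not> satisfies v \<alpha>) \<or> (\<exists>\<alpha>. \<alpha> |\<in>| \<Delta> \<and> satisfies v \<alpha>)"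

definition valid :: "fm fset \<Rightarrow> fm fset \<Rightarrow> bool" where
  "valid \<Gamma> \<Delta> \<longleftrightarrow> (\<forall>v. valuation v \<longrightarrow> satisfies_sequent v \<Gamma> \<Delta>)"

text \<open>The Boolean argument records whether the cut rule may be used. Since sides are finite sets,
  the displayed formula of a rule may also occur in its context, and contraction and exchange
  are implicit.\<close>

inductive derivable :: "bool \<Rightarrow> fm fset \<Rightarrow> fm fset \<Rightarrow> bool" for cut :: bool where
  Ax: "derivable cut {|\<alpha>|} {|\<alpha>|}"
| Cut: "cut \<Longrightarrow> derivable cut \<Gamma> (finsert \<alpha> \<Delta>) \<Longrightarrow> derivable cut (finsert \<alpha> \<Gamma>) \<Delta> \<Longrightarrow> derivable cut \<Gamma> \<Delta>"
| WeakL: "derivable cut \<Gamma> \<Delta> \<Longrightarrow> derivable cut (finsert \<alpha> \<Gamma>) \<Delta>"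
| WeakR: "derivable cut \<Gamma> \<Delta> \<Longrightarrow> derivable cut \<Gamma> (finsert \<alpha> \<Delta>)"
| DisjL: "derivable cut (finsert \<alpha> \<Gamma>) \<Delta> \<Longrightarrow> derivable cut (finsert \<beta> \<Gamma>) \<Delta> \<Longrightarrow>
    derivable cut (finsert (Disj \<alpha> \<beta>) \<Gamma>) \<Delta>"
| DisjR: "derivable cut \<Gamma> (finsert \<alpha> (finsert \<beta> \<Delta>)) \<Longrightarrow> derivable cut \<Gamma> (finsert (Disj \<alpha> \<beta>) \<Delta>)"
| NegDisjL: "derivable cut (finsert (Neg \<alpha>) (finsert (Neg \<beta>) \<Gamma>)) \<Delta> \<Longrightarrow>
    derivable cut (finsert (Neg (Disj \<alpha> \<beta>)) \<Gamma>) \<Delta>"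
| NegDisjR: "derivable cut \<Gamma> (finsert (Neg \<alpha>) \<Delta>) \<Longrightarrow> derivable cut \<Gamma> (finsert (Neg \<beta>) \<Delta>) \<Longrightarrow>
    derivable cut \<Gamma> (finsert (Neg (Disj \<alpha> \<beta>)) \<Delta>)"
| ConjL: "derivable cut (finsert \<alpha> (finsert \<beta> \<Gamma>)) \<Delta> \<Longrightarrow> derivable cut (finsert (Conj \<alpha> \<beta>) \<Gamma>) \<Delta>"
| ConjR: "derivable cut \<Gamma> (finsert \<alpha> \<Delta>) \<Longrightarrow> derivable cut \<Gamma> (finsert \<beta> \<Delta>) \<Longrightarrow>
    derivable cut \<Gamma> (finsert (Conj \<alpha> \<beta>) \<Delta>)"
| NegConjL: "derivable cut (finsert (Neg \<alpha>) \<Gamma>) \<Delta> \<Longrightarrow> derivable cut (finsert (Neg \<beta>) \<Gamma>) \<Delta> \<Longrightarrow>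
    derivable cut (finsert (Neg (Conj \<alpha> \<beta>)) \<Gamma>) \<Delta>"
| NegConjR: "derivable cut \<Gamma> (finsert (Neg \<alpha>) (finsert (Neg \<beta>) \<Delta>)) \<Longrightarrow>
    derivable cut \<Gamma> (finsert (Neg (Conj \<alpha> \<beta>)) \<Delta>)"
| NegNegL: "derivable cut (finsert \<alpha> \<Gamma>) \<Delta> \<Longrightarrow> derivable cut (finsert (Neg (Neg \<alpha>)) \<Gamma>) \<Delta>"
| NegNegR: "derivable cut \<Gamma> (finsert \<alpha> \<Delta>) \<Longrightarrow> derivable cut \<Gamma> (finsert (Neg (Neg \<alpha>)) \<Delta>)"
| BoxL1: "derivable cut (finsert \<alpha> \<Gamma>) \<Delta> \<Longrightarrow> derivable cut (finsert (Box \<alpha>) \<Gamma>) \<Delta>"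
| BoxL2: "derivable cut \<Gamma> (finsert (Neg \<alpha>) \<Delta>) \<Longrightarrow> derivable cut (finsert (Box \<alpha>) \<Gamma>) \<Delta>"
| BoxR: "derivable cut \<Gamma> (finsert \<alpha> \<Delta>) \<Longrightarrow> derivable cut (finsert (Neg \<alpha>) \<Gamma>) \<Delta> \<Longrightarrow>
    derivable cut \<Gamma> (finsert (Box \<alpha>) \<Delta>)"
| NegBoxL: "derivable cut \<Gamma> (finsert \<alpha> \<Delta>) \<Longrightarrow> derivable cut (finsert (Neg \<alpha>) \<Gamma>) \<Delta> \<Longrightarrow>
    derivable cut (finsert (Neg (Box \<alpha>)) \<Gamma>) \<Delta>"
| NegBoxR1: "derivable cut (finsert \<alpha> \<Gamma>) \<Delta> \<Longrightarrow> derivable cut \<Gamma> (finsert (Neg (Box \<alpha>)) \<Delta>)"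
| NegBoxR2: "derivable cut \<Gamma> (finsert (Neg \<alpha>) \<Delta>) \<Longrightarrow> derivable cut \<Gamma> (finsert (Neg (Box \<alpha>)) \<Delta>)"

definition provable :: "fm fset \<Rightarrow> fm fset \<Rightarrow> bool" where
  "provable \<Gamma> \<Delta> \<longleftrightarrow> derivable True \<Gamma> \<Delta>"

definition cut_free_provable :: "fm fset \<Rightarrow> fm fset \<Rightarrow> bool" where
  "cut_free_provable \<Gamma> \<Delta> \<longleftrightarrow> derivable False \<Gamma> \<Delta>"

end

theory Submission
  imports Defs
begin

text \<open>A truth value of the matrix is determined by two bits: whether \<open>\<alpha>\<close> is designated and whether
  \<open>Neg \<alpha>\<close> is. Through these bits every compound formula, and every negated compound formula, becomes
  a classical condition on its immediate subformulas and their negations; for example \<open>Box \<alpha>\<close> is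
  designated iff \<open>\<alpha>\<close> is and \<open>Neg \<alpha>\<close> is not. The rules of the calculus spell out exactly these
  conditions, and soundness follows by rule induction.

  Conversely, the conditions are equivalences, so the rules can be read backwards: a valid sequent
  with a formula that is neither a variable nor a negated variable is the conclusion of one rule, or
  two successive rules, whose premises are again valid; cut is not among them. The
  premises are smaller for a weight under which \<open>Box \<alpha>\<close> and \<open>Neg (Box \<alpha>)\<close> outweigh \<open>\<alpha>\<close> and \<open>Neg \<alpha>\<close>
  together. Reduction ends with sequents of variables and negated variables. Since the two bits of a
  variable can be chosen independently, such a sequent is valid only if its sides share a formula, in
  which case it is a weakened axiom. Hence every valid sequent has a cut-free derivation, and cut
  is admissible because derivations with cut are sound.\<close>

section \<open>Semantics by designation\<close>

text \<open>The two bits of a value are independent, negation swaps them, and in both bits the lattice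
  operations act as classical connectives, dually in the second. Only \<open>One\<close> has the first bit set and
  the second one not, which is the condition for \<open>Box\<close>. Read from left to right, these equivalences
  are the logical rules.\<close>

lemma satisfies_valuation:
  assumes "valuation v"
  shows "satisfies v (Disj \<alpha> \<beta>) \<longleftrightarrow> satisfies v \<alpha> \<or> satisfies v \<beta>"
    and "satisfies v (Neg (Disj \<alpha> \<beta>)) \<longleftrightarrow> satisfies v (Neg \<alpha>) \<and> satisfies v (Neg \<beta>)"
    and "satisfies v (Conj \<alpha> \<beta>) \<longleftrightarrow> satisfies v \<alpha> \<and> satisfies v \<beta>"
    and "satisfies v (Neg (Conj \<alpha> \<beta>)) \<longleftrightarrow> satisfies v (Neg \<alpha>) \<or> satisfies v (Neg \<beta>)"
    and "satisfies v (Neg (Neg \<alpha>)) \<longleftrightarrow> satisfies v \<alpha>"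
    and "satisfies v (Box \<alpha>) \<longleftrightarrow> satisfies v \<alpha> \<and> \<not> satisfies v (Neg \<alpha>)"
    and "satisfies v (Neg (Box \<alpha>)) \<longleftrightarrow> \<not> satisfies v \<alpha> \<or> satisfies v (Neg \<alpha>)"
  using assms
  by (cases "v \<alpha>"; cases "v \<beta>";
      simp add: satisfies_def valuation_def designated_def sup_tv_def inf_tv_def less_eq_tv_def)+

text \<open>With these two equations, passing from premises to conclusion or back becomes propositional
  reasoning in which satisfaction of the context is a single atom.\<close>

lemma satisfies_sequent_finsert:
  "satisfies_sequent v (finsert \<alpha> \<Gamma>) \<Delta> \<longleftrightarrow> \<not> satisfies v \<alpha> \<or> satisfies_sequent v \<Gamma> \<Delta>"
  "satisfies_sequent v \<Gamma> (finsert \<alpha> \<Delta>) \<longleftrightarrow> satisfies v \<alpha> \<or> satisfies_sequent v \<Gamma> \<Delta>"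
  by (auto simp: satisfies_sequent_def)

lemma derivable_satisfies_sequent:
  assumes "derivable c \<Gamma> \<Delta>" and "valuation v"
  shows "satisfies_sequent v \<Gamma> \<Delta>"
  using assms
  by induction (auto simp: satisfies_sequent_finsert satisfies_valuation)

theorem soundness: "derivable c \<Gamma> \<Delta> \<Longrightarrow> valid \<Gamma> \<Delta>"
  by (simp add: valid_def derivable_satisfies_sequent)

section \<open>Sequents of literals\<close>

fun literal :: "fm \<Rightarrow> bool" where
  "literal (Var p) \<longleftrightarrow> True"
| "literal (Neg (Var p)) \<longleftrightarrow> True"
| "literal _ \<longleftrightarrow> False"

lemma nonliteral_cases:
  assumes "\<not> literal \<phi>"
  obtains (Disj) \<alpha> \<beta> where "\<phi> = Disj \<alpha> \<beta>"
    | (NegDisj) \<alpha> \<beta> where "\<phi> = Neg (Disj \<alpha> \<beta>)"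
    | (Conj) \<alpha> \<beta> where "\<phi> = Conj \<alpha> \<beta>"
    | (NegConj) \<alpha> \<beta> where "\<phi> = Neg (Conj \<alpha> \<beta>)"
    | (NegNeg) \<alpha> where "\<phi> = Neg (Neg \<alpha>)"
    | (Box) \<alpha> where "\<phi> = Box \<alpha>"
    | (NegBox) \<alpha> where "\<phi> = Neg (Box \<alpha>)"
  using assms by (cases \<phi> rule: literal.cases) auto

primrec extend :: "(nat \<Rightarrow> tv) \<Rightarrow> fm \<Rightarrow> tv" where
  "extend e (Var p) = e p"
| "extend e (Disj \<alpha> \<beta>) = sup (extend e \<alpha>) (extend e \<beta>)"
| "extend e (Conj \<alpha> \<beta>) = inf (extend e \<alpha>) (extend e \<beta>)"
| "extend e (Neg \<alpha>) = neg_tv (extend e \<alpha>)"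
| "extend e (Box \<alpha>) = box_tv (extend e \<alpha>)"

lemma valuation_extend: "valuation (extend e)"
  by (simp add: valuation_def)

text \<open>The two bits of a variable are independent: all four combinations are truth values.\<close>

lemma ex_valuation_literals:
  "\<exists>v. valuation v \<and> (\<forall>\<alpha>. literal \<alpha> \<longrightarrow> (satisfies v \<alpha> \<longleftrightarrow> \<alpha> \<in> S))"
proof -
  define e where "e p =
    (if Var p \<in> S then if Neg (Var p) \<in> S then B else One
     else if Neg (Var p) \<in> S then Zero else N)" for p
  have "satisfies (extend e) \<alpha> \<longleftrightarrow> \<alpha> \<in> S" if "literal \<alpha>" for \<alpha>
    using that by (cases \<alpha> rule: literal.cases) (auto simp: satisfies_def designated_def e_def)
  then show ?thesis
    using valuation_extend by blast
qed

lemma valid_literals_share: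
  assumes "valid \<Gamma> \<Delta>"
    and "\<And>\<alpha>. \<alpha> |\<in>| \<Gamma> \<Longrightarrow> literal \<alpha>" and "\<And>\<alpha>. \<alpha> |\<in>| \<Delta> \<Longrightarrow> literal \<alpha>"
  obtains \<alpha> where "\<alpha> |\<in>| \<Gamma>" and "\<alpha> |\<in>| \<Delta>"
proof -
  obtain v where "valuation v" and "\<And>\<alpha>. literal \<alpha> \<Longrightarrow> satisfies v \<alpha> \<longleftrightarrow> \<alpha> \<in> fset \<Gamma>"
    using ex_valuation_literals[of "fset \<Gamma>"] by blast
  then show thesis
    using assms that unfolding valid_def satisfies_sequent_def by metis
qed

lemma derivable_shared:
  assumes "\<alpha> |\<in>| \<Gamma>" and "\<alpha> |\<in>| \<Delta>"
  shows "derivable c \<Gamma> \<Delta>"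
proof -
  have "derivable c (finsert \<alpha> \<Gamma>') {|\<alpha>|}" for \<Gamma>'
    by (induction \<Gamma>') (metis derivable.Ax, metis derivable.WeakL finsert_commute)
  then have "derivable c (finsert \<alpha> \<Gamma>') (finsert \<alpha> \<Delta>')" for \<Gamma>' \<Delta>'
    by (induction \<Delta>') (metis, metis derivable.WeakR finsert_commute)
  then show ?thesis
    using assms by (metis finsert_absorb)
qed

section \<open>Reducing valid sequents\<close>

text \<open>The summand 2 at a binary connective pays for the two negations created when a negation is
  pushed through it, and the doubling at \<open>Box\<close> pays for both \<open>\<alpha>\<close> and \<open>Neg \<alpha>\<close>.\<close>

primrec weight :: "fm \<Rightarrow> nat" where
  "weight (Var p) = 1"
| "weight (Disj \<alpha> \<beta>) = weight \<alpha> + weight \<beta> + 2"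
| "weight (Conj \<alpha> \<beta>) = weight \<alpha> + weight \<beta> + 2"
| "weight (Neg \<alpha>) = weight \<alpha> + 1"
| "weight (Box \<alpha>) = 2 * weight \<alpha> + 2"

definition total_weight :: "fm fset \<Rightarrow> nat" where
  "total_weight \<Gamma> = (\<Sum>\<alpha>\<in>fset \<Gamma>. weight \<alpha>)"

lemma total_weight_insert_le: "total_weight (finsert \<alpha> \<Gamma>) \<le> weight \<alpha> + total_weight \<Gamma>"
  by (cases "\<alpha> |\<in>| \<Gamma>") (auto simp: total_weight_def finsert_absorb insert_absorb)

lemma total_weight_insert2_le:
  "total_weight (finsert \<alpha> (finsert \<beta> \<Gamma>)) \<le> weight \<alpha> + weight \<beta> + total_weight \<Gamma>"
  using total_weight_insert_le[of \<alpha> "finsert \<beta> \<Gamma>"] total_weight_insert_le[of \<beta> \<Gamma>] by linarith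

lemma total_weight_insert: "\<alpha> |\<notin>| \<Gamma> \<Longrightarrow> total_weight (finsert \<alpha> \<Gamma>) = weight \<alpha> + total_weight \<Gamma>"
  by (simp add: total_weight_def)

text \<open>The left rules for connectives other than \<open>Box\<close> are invertible, so their premises inherit
  validity from the conclusion. Each of the two rules for \<open>Box \<alpha>\<close> uses only one half of its satisfaction
  condition, and possibly neither has a valid premise: for a variable \<open>p\<close> and the sequent with \<open>Box p\<close>
  on both sides, the value \<open>B\<close> refutes one premise and \<open>N\<close> the other. Validity is instead inherited by
  the sequent with \<open>\<alpha>\<close> added on the left and \<open>Neg \<alpha>\<close> on the right, from which both rules in succession
  lead back.\<close>

lemma derivable_reduce_left:
  assumes smaller: "\<And>\<Gamma>' \<Delta>'. total_weight \<Gamma>' + total_weight \<Delta>' < total_weight \<Gamma> + total_weight \<Delta> \<Longrightarrow>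
      valid \<Gamma>' \<Delta>' \<Longrightarrow> derivable c \<Gamma>' \<Delta>'"
    and valid: "valid \<Gamma> \<Delta>" and mem: "\<phi> |\<in>| \<Gamma>" and "\<not> literal \<phi>"
  shows "derivable c \<Gamma> \<Delta>"
proof -
  \<comment> \<open>The context must lack the formula: otherwise removing it would not lower the weight.\<close>
  obtain G where G: "\<Gamma> = finsert \<phi> G" "\<phi> |\<notin>| G"
    using mem by (meson mk_disjoint_finsert)
  have reduce: "derivable c \<Gamma>' \<Delta>'"
    if "total_weight \<Gamma>' + total_weight \<Delta>' < weight \<phi> + total_weight G + total_weight \<Delta>"
      and "valid \<Gamma>' \<Delta>'" for \<Gamma>' \<Delta>'
    using smaller that by (simp add: G total_weight_insert)
  have single: "derivable c (finsert \<alpha> G) \<Delta>"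
    if "weight \<alpha> < weight \<phi>" and "valid (finsert \<alpha> G) \<Delta>" for \<alpha>
    using that total_weight_insert_le[of \<alpha> G] by (intro reduce) linarith+
  have double: "derivable c (finsert \<alpha> (finsert \<beta> G)) \<Delta>"
    if "weight \<alpha> + weight \<beta> < weight \<phi>" and "valid (finsert \<alpha> (finsert \<beta> G)) \<Delta>" for \<alpha> \<beta>
    using that total_weight_insert2_le[of \<alpha> \<beta> G] by (intro reduce) linarith+
  have right: "derivable c G (finsert \<alpha> \<Delta>)"
    if "weight \<alpha> < weight \<phi>" and "valid G (finsert \<alpha> \<Delta>)" for \<alpha>
    using that total_weight_insert_le[of \<alpha> \<Delta>] by (intro reduce) linarith+
  have across: "derivable c (finsert \<alpha> G) (finsert \<beta> \<Delta>)"
    if "weight \<alpha> + weight \<beta> < weight \<phi>" and "valid (finsert \<alpha> G) (finsert \<beta> \<Delta>)" for \<alpha> \<beta>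
    using that total_weight_insert_le[of \<alpha> G] total_weight_insert_le[of \<beta> \<Delta>] by (intro reduce) linarith+
  note sem = valid_def satisfies_sequent_finsert satisfies_valuation
  have valid': "valid (finsert \<phi> G) \<Delta>"
    using valid G(1) by simp
  have "derivable c (finsert \<phi> G) \<Delta>"
    using \<open>\<not> literal \<phi>\<close>
  proof (cases \<phi> rule: nonliteral_cases)
    case (Disj \<alpha> \<beta>)
    show ?thesis
      using valid' unfolding Disj
      by (intro derivable.DisjL single) (auto simp: Disj sem)
  next
    case (Conj \<alpha> \<beta>)
    show ?thesis
      using valid' unfolding Conj
      by (intro derivable.ConjL double) (auto simp: Conj sem)
  next
    case (NegDisj \<alpha> \<beta>)
    show ?thesis
      using valid' unfolding NegDisj
      by (intro derivable.NegDisjL double) (auto simp: NegDisj sem)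
  next
    case (NegConj \<alpha> \<beta>)
    show ?thesis
      using valid' unfolding NegConj
      by (intro derivable.NegConjL single) (auto simp: NegConj sem)
  next
    case (NegNeg \<alpha>)
    show ?thesis
      using valid' unfolding NegNeg
      by (intro derivable.NegNegL single) (auto simp: NegNeg sem)
  next
    case (NegBox \<alpha>)
    show ?thesis
      using valid' unfolding NegBox
      by (intro derivable.NegBoxL single right) (auto simp: NegBox sem)
  next
    case (Box \<alpha>)
    have "derivable c (finsert \<alpha> G) (finsert (Neg \<alpha>) \<Delta>)"
      using valid' unfolding Box by (intro across) (auto simp: Box sem)
    \<comment> \<open>Each rule introduces its own copy of the formula; the copies coincide as set elements.\<close>
    then have "derivable c (finsert (Box \<alpha>) (finsert (Box \<alpha>) G)) \<Delta>"
      by (intro derivable.BoxL2 derivable.BoxL1)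
    then show ?thesis
      by (simp add: Box)
  qed
  then show ?thesis
    by (simp add: G(1))
qed

text \<open>On the right the exceptional case is \<open>Neg (Box \<alpha>)\<close>, which is satisfied if \<open>\<alpha>\<close> is not or if
  \<open>Neg \<alpha>\<close> is, with one rule for each alternative.\<close>

lemma derivable_reduce_right:
  assumes smaller: "\<And>\<Gamma>' \<Delta>'. total_weight \<Gamma>' + total_weight \<Delta>' < total_weight \<Gamma> + total_weight \<Delta> \<Longrightarrow>
      valid \<Gamma>' \<Delta>' \<Longrightarrow> derivable c \<Gamma>' \<Delta>'"
    and valid: "valid \<Gamma> \<Delta>" and mem: "\<phi> |\<in>| \<Delta>" and "\<not> literal \<phi>"
  shows "derivable c \<Gamma> \<Delta>"
proof -
  obtain D where D: "\<Delta> = finsert \<phi> D" "\<phi> |\<notin>| D"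
    using mem by (meson mk_disjoint_finsert)
  have reduce: "derivable c \<Gamma>' \<Delta>'"
    if "total_weight \<Gamma>' + total_weight \<Delta>' < total_weight \<Gamma> + weight \<phi> + total_weight D"
      and "valid \<Gamma>' \<Delta>'" for \<Gamma>' \<Delta>'
    using smaller that by (simp add: D total_weight_insert)
  have single: "derivable c \<Gamma> (finsert \<alpha> D)"
    if "weight \<alpha> < weight \<phi>" and "valid \<Gamma> (finsert \<alpha> D)" for \<alpha>
    using that total_weight_insert_le[of \<alpha> D] by (intro reduce) linarith+
  have double: "derivable c \<Gamma> (finsert \<alpha> (finsert \<beta> D))"
    if "weight \<alpha> + weight \<beta> < weight \<phi>" and "valid \<Gamma> (finsert \<alpha> (finsert \<beta> D))" for \<alpha> \<beta>
    using that total_weight_insert2_le[of \<alpha> \<beta> D] by (intro reduce) linarith+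
  have left: "derivable c (finsert \<alpha> \<Gamma>) D"
    if "weight \<alpha> < weight \<phi>" and "valid (finsert \<alpha> \<Gamma>) D" for \<alpha>
    using that total_weight_insert_le[of \<alpha> \<Gamma>] by (intro reduce) linarith+
  have across: "derivable c (finsert \<alpha> \<Gamma>) (finsert \<beta> D)"
    if "weight \<alpha> + weight \<beta> < weight \<phi>" and "valid (finsert \<alpha> \<Gamma>) (finsert \<beta> D)" for \<alpha> \<beta>
    using that total_weight_insert_le[of \<alpha> \<Gamma>] total_weight_insert_le[of \<beta> D] by (intro reduce) linarith+
  note sem = valid_def satisfies_sequent_finsert satisfies_valuation
  have valid': "valid \<Gamma> (finsert \<phi> D)"
    using valid D(1) by simp
  have "derivable c \<Gamma> (finsert \<phi> D)"
    using \<open>\<not> literal \<phi>\<close>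
  proof (cases \<phi> rule: nonliteral_cases)
    case (Disj \<alpha> \<beta>)
    show ?thesis
      using valid' unfolding Disj
      by (intro derivable.DisjR double) (auto simp: Disj sem)
  next
    case (Conj \<alpha> \<beta>)
    show ?thesis
      using valid' unfolding Conj
      by (intro derivable.ConjR single) (auto simp: Conj sem)
  next
    case (NegDisj \<alpha> \<beta>)
    show ?thesis
      using valid' unfolding NegDisj
      by (intro derivable.NegDisjR single) (auto simp: NegDisj sem)
  next
    case (NegConj \<alpha> \<beta>)
    show ?thesis
      using valid' unfolding NegConj
      by (intro derivable.NegConjR double) (auto simp: NegConj sem)
  next
    case (NegNeg \<alpha>)
    show ?thesis
      using valid' unfolding NegNeg
      by (intro derivable.NegNegR single) (auto simp: NegNeg sem)
  next
    case (NegBox \<alpha>)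
    have "derivable c (finsert \<alpha> \<Gamma>) (finsert (Neg \<alpha>) D)"
      using valid' unfolding NegBox by (intro across) (auto simp: NegBox sem)
    then have "derivable c \<Gamma> (finsert (Neg \<alpha>) (finsert (Neg (Box \<alpha>)) D))"
      by (subst finsert_commute) (rule derivable.NegBoxR1)
    then have "derivable c \<Gamma> (finsert (Neg (Box \<alpha>)) (finsert (Neg (Box \<alpha>)) D))"
      by (rule derivable.NegBoxR2)
    then show ?thesis
      by (simp add: NegBox)
  next
    case (Box \<alpha>)
    show ?thesis
      using valid' unfolding Box
      by (intro derivable.BoxR single left) (auto simp: Box sem)
  qed
  then show ?thesis
    by (simp add: D(1))
qed

text \<open>The parameter \<open>c\<close> is arbitrary here, since the reduction never applies the cut rule; so one
  statement gives completeness both with and without cut.\<close>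

theorem completeness: "valid \<Gamma> \<Delta> \<Longrightarrow> derivable c \<Gamma> \<Delta>"
proof (induction "total_weight \<Gamma> + total_weight \<Delta>" arbitrary: \<Gamma> \<Delta> rule: less_induct)
  case less
  show ?case
  proof (cases "(\<forall>\<phi>. \<phi> |\<in>| \<Gamma> \<longrightarrow> literal \<phi>) \<and> (\<forall>\<phi>. \<phi> |\<in>| \<Delta> \<longrightarrow> literal \<phi>)")
    case True
    then obtain \<alpha> where "\<alpha> |\<in>| \<Gamma>" and "\<alpha> |\<in>| \<Delta>"
      using valid_literals_share[OF less.prems] by blast
    then show ?thesis
      by (rule derivable_shared)
  next
    case False
    then consider \<phi> where "\<phi> |\<in>| \<Gamma>" "\<not> literal \<phi>" | \<phi> where "\<phi> |\<in>| \<Delta>" "\<not> literal \<phi>"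
      by blast
    then show ?thesis
      using derivable_reduce_left[OF less.hyps less.prems]
        derivable_reduce_right[OF less.hyps less.prems] by cases blast+
  qed
qed

section \<open>Soundness, completeness and cut admissibility\<close>

theorem theorem5p6:
  shows "(\<forall>\<Gamma> \<Delta>. provable \<Gamma> \<Delta> \<longleftrightarrow> valid \<Gamma> \<Delta>) \<and>
    (\<forall>\<Gamma> \<Delta>. provable \<Gamma> \<Delta> \<longrightarrow> cut_free_provable \<Gamma> \<Delta>)"
  unfolding provable_def cut_free_provable_def
  using soundness completeness by blast

end
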